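(* For all integers $n\ge 1$, $$\sum_{k=0}^n \overline{p}(k)\,\sigma_{o-e}(n-k)\ge 0.$$
   Context: An overpartition of a nonnegative integer $n$ is a partition of $n$ in which the first occurrence of each distinct part may be overlined (or not). $\overline{p}(n)$ is the number of overpartitions of $n$, with $\overline{p}(0)=1$. For a positive integer $a$, $\sigma_{o-e}(a)$ denotes the sum of the odd positive divisors $d$ of $a$ for which $a/d$ is odd, minus the sum of the even positive divisors $d$ of $a$ for which $a/d$ is odd; by convention $\sigma_{o-e}(0)=0$. *)

theory Defs
  imports "HOL-Library.Multiset"
begin

definition partitions :: "nat \<Rightarrow> nat multiset set" where
  "partitions n = {M. 0 \<notin># M \<and> sum_mset M = n}"

(* Only the first occurrence of each distinct part can be overlined, so an overpartition
   is a partition M together with the set S of those distinct parts of M whose first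
   occurrence is overlined. *)
definition overpartitions :: "nat \<Rightarrow> (nat multiset \<times> nat set) set" where
  "overpartitions n = {(M, S). M \<in> partitions n \<and> S \<subseteq> set_mset M}"

definition overpartition_count :: "nat \<Rightarrow> nat" where
  "overpartition_count n = card (overpartitions n)"

definition sigma_oe :: "nat \<Rightarrow> int" where
  "sigma_oe a =
     (if a = 0 then 0
      else (\<Sum>d | d dvd a \<and> odd d \<and> odd (a div d). int d)
         - (\<Sum>d | d dvd a \<and> even d \<and> odd (a div d). int d))"

lemma size_le_sum_mset: "0 \<notin># M \<Longrightarrow> size M \<le> sum_mset (M :: nat multiset)"
  by (induction M) auto

lemma finite_partitions: "finite (partitions n)"
proof (rule finite_subset)
  show "partitions n \<subseteq> mset ` {xs. set xs \<subseteq> {..n} \<and> length xs \<le> n}"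
  proof
    fix M assume M: "M \<in> partitions n"
    obtain xs where xs: "M = mset xs" by (metis ex_mset)
    have "set xs \<subseteq> {..n}"
      using M xs by (auto simp: partitions_def sum_mset_sum_list member_le_sum_list)
    moreover have "length xs \<le> n"
      using M xs size_le_sum_mset[of M] by (auto simp: partitions_def)
    ultimately show "M \<in> mset ` {xs. set xs \<subseteq> {..n} \<and> length xs \<le> n}"
      using xs by auto
  qed
qed (simp add: finite_lists_length_le)

(* Hence the cardinality in overpartition_count is a genuine count. *)
lemma finite_overpartitions: "finite (overpartitions n)"
proof -
  have "overpartitions n = (SIGMA M:partitions n. Pow (set_mset M))"
    by (auto simp: overpartitions_def)
  then show ?thesis by (auto simp: finite_partitions)
qed

lemma overpartition_count_0: "overpartition_count 0 = 1"
proof -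
  have "M = {#}" if "M \<in> partitions 0" for M
    using that size_le_sum_mset[of M] unfolding partitions_def mem_Collect_eq
    by (metis le_zero_eq size_eq_0_iff_empty)
  then have "overpartitions 0 = {({#}, {})}"
    by (auto simp: overpartitions_def partitions_def)
  then show ?thesis by (simp add: overpartition_count_def)
qed

end

theory Submission
  imports Defs "HOL-Computational_Algebra.Formal_Power_Series"
begin

text \<open>
  Write \<open>P(q)\<close> for the product of \<open>(1 + q^k) / (1 - q^k)\<close> over \<open>k \<ge> 1\<close>, the generating function
  of overpartitions, and \<open>S(q)\<close> for the generating function of \<^const>\<open>sigma_oe\<close>; the sums
  in question are the coefficients of \<open>P S\<close>.  Expanding geometric series gives
  \<open>S(q) = - (\<Sum>k. (-1)^k k q^k / (1 - q^(2 k)))\<close>, and this is half the logarithmic derivative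
  \<open>q R'(q) / R(q)\<close> of \<open>R(q) = 1 / P(-q)\<close>.  Hence
  \<open>2 P(q) S(q) = P(q) P(-q) q R'(q)\<close>.

  Both factors on the right have nonnegative coefficients.  In \<open>P(q) P(-q)\<close> the factors with odd
  \<open>k\<close> cancel and those with even \<open>k\<close> become squares, so that \<open>P(q) P(-q) = P(q^2)^2\<close>.  And by
  Gauss's theta identity \<open>R(q) = 1 + 2 (q + q^4 + q^9 + \<dots>)\<close>.

  Only finite products occur below.  A product truncated at \<open>N\<close> has the correct coefficients up to
  \<open>q^N\<close>, which suffices for the \<open>N\<close>-th sum.  The logarithmic derivative and the
  cancellation hold exactly for truncated products
  (\<open>theta_product_log_deriv\<close>, \<open>overpartition_product_eq_nonneg_mult_theta_product\<close>), and the theta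
  identity is needed only modulo \<open>q^(N+1)\<close> (\<open>fps_nth_theta_product\<close>), where it follows from a finite
  telescoping identity in the manner of Shanks (\<open>shanks_square_identity\<close>).
\<close>

unbundle fps_syntax

section \<open>A finite form of Gauss's theta identity\<close>

text \<open>With \<open>R n\<close> the product of \<open>(1 - q^k) / (1 + q^k)\<close> over \<open>k \<le> n\<close>, the summand on the left is
  \<open>2 (-1)^s q^(s (n + 1)) / (1 + q^s) * R n / R s\<close>.  The summand \<open>s = 0\<close> is \<open>R n\<close> itself, as
  \<open>A 0\<close> cancels the factor \<open>2\<close>, and all others are multiples of \<open>q^(n + 1)\<close>: up to order \<open>n\<close> the
  product \<open>R n\<close> thus agrees with the partial theta series.  In the induction on \<open>n\<close>, the
  increments of the summands telescope in \<open>s\<close>.  The family \<open>A\<close> of inverses stands in for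
  division, since power series do not form a field.\<close>

lemma shanks_square_identity:
  fixes q :: "'a :: comm_ring_1" and A :: "nat \<Rightarrow> 'a"
  assumes A: "\<And>k. A k * (1 + q ^ k) = 1"
  shows "(\<Sum>s\<le>n. 2 * (- 1) ^ s * q ^ (s * Suc n) * A s * (\<Prod>k\<in>{s<..n}. (1 - q ^ k) * A k))
           = 1 + 2 * (\<Sum>s=1..n. (- 1) ^ s * q ^ (s\<^sup>2))"
proof -
  define r where "r k = (1 - q ^ k) * A k" for k
  define u where "u n s = 2 * (- 1) ^ s * q ^ (s * Suc n) * A s * (\<Prod>k\<in>{s<..n}. r k)" for n s
  have "(\<Sum>s\<le>n. u n s) = 1 + 2 * (\<Sum>s=1..n. (- 1) ^ s * q ^ (s\<^sup>2))"
  proof (induction n)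
    case 0
    show ?case using A[of 0] by (simp add: u_def mult.commute)
  next
    case (Suc n)
    let ?m = "Suc n"
    \<comment> \<open>The empty case \<open>j = 0\<close> is correct because the product then contains \<open>1 - q^0 = 0\<close>.\<close>
    have telescope: "(\<Sum>s<j. u ?m s - u n s) = 2 * (- 1) ^ j * q ^ (j * ?m) * A ?m * (\<Prod>k\<in>{j..n}. r k)"
      if "j \<le> ?m" for j
      using that
    proof (induction j)
      case 0
      have "(\<Prod>k\<in>{0..n}. r k) = 0" by (rule prod_zero) (auto simp: r_def intro!: bexI[of _ 0])
      then show ?case by simp
    next
      case (Suc j)
      define B where "B = (\<Prod>k\<in>{j<..n}. r k)"
      have "{j<..?m} = insert ?m {j<..n}" "{j..n} = insert j {j<..n}" "{Suc j..n} = {j<..n}"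
        using Suc.prems by auto
      then have B: "(\<Prod>k\<in>{j<..?m}. r k) = r ?m * B" "(\<Prod>k\<in>{j..n}. r k) = r j * B"
          "(\<Prod>k\<in>{Suc j..n}. r k) = B"
        by (simp_all add: B_def)
      have key: "A j * (q ^ j * r ?m - 1) = - A ?m * (q ^ ?m + r j)"
      proof -
        have x: "A j * q ^ j = 1 - A j" and y: "A ?m * q ^ ?m = 1 - A ?m"
          using A[of j] A[of ?m] by (simp_all add: algebra_simps del: power_Suc)
        have "A j * (q ^ j * r ?m - 1) = (A j * q ^ j) * (A ?m - A ?m * q ^ ?m) - A j"
          unfolding r_def by (simp add: algebra_simps del: power_Suc)
        also have "\<dots> = - (A ?m * q ^ ?m) - A ?m * (A j - A j * q ^ j)"
          unfolding x y by (simp add: algebra_simps)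
        also have "\<dots> = - A ?m * (q ^ ?m + r j)"
          unfolding r_def by (simp add: algebra_simps del: power_Suc)
        finally show ?thesis .
      qed
      have "u ?m j - u n j = 2 * (- 1) ^ j * q ^ (j * ?m) * B * (A j * (q ^ j * r ?m - 1))"
        unfolding u_def B B_def[symmetric] by (simp add: algebra_simps power_add)
      also have "\<dots> = 2 * (- 1) ^ Suc j * q ^ (Suc j * ?m) * A ?m * B
                      - 2 * (- 1) ^ j * q ^ (j * ?m) * A ?m * (r j * B)"
        unfolding key by (simp add: algebra_simps power_add)
      finally show ?case
        using Suc by (simp add: B)
    qed
    have "(\<Sum>s\<le>?m. u ?m s) - (\<Sum>s\<le>n. u n s) = (\<Sum>s<?m. u ?m s - u n s) + u ?m ?m"
      by (simp add: sum_subtractf lessThan_Suc_atMost)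
    also have "\<dots> = 2 * (- 1) ^ ?m * q ^ (?m * ?m) * (A ?m * (1 + q ^ ?m))"
      unfolding telescope[OF order_refl] by (simp add: u_def algebra_simps power_add)
    also have "\<dots> = 2 * ((- 1) ^ ?m * q ^ (?m\<^sup>2))"
      unfolding A by (simp add: power2_eq_square)
    finally show ?case unfolding Suc.IH by (simp add: algebra_simps)
  qed
  then show ?thesis by (simp add: u_def r_def)
qed

section \<open>The generating function of overpartitions\<close>

text \<open>Overpartitions of \<open>n\<close> with all parts at most \<open>N\<close>: each partition is weighted with the number of
  ways to overline its distinct parts.\<close>

definition overpartition_weight :: "nat \<Rightarrow> nat \<Rightarrow> nat" where
  "overpartition_weight N n = (\<Sum>M | set_mset M \<subseteq> {1..N} \<and> sum_mset M = n. 2 ^ card (set_mset M))"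

lemma finite_bounded_partitions:
  "finite {M. set_mset M \<subseteq> {1..N::nat} \<and> sum_mset M = n}"
  by (rule finite_subset[OF _ finite_partitions[of n]]) (auto simp: partitions_def)

lemma overpartition_count_eq_weight:
  assumes "n \<le> N"
  shows "overpartition_count n = overpartition_weight N n"
proof -
  have part_le: "x \<le> sum_mset M" if "x \<in># M" for x :: nat and M
    using that by (auto dest!: multi_member_split)
  have "overpartitions n = (SIGMA M:partitions n. Pow (set_mset M))"
    by (auto simp: overpartitions_def)
  then have "overpartition_count n = (\<Sum>M\<in>partitions n. 2 ^ card (set_mset M))"
    by (simp add: overpartition_count_def finite_partitions card_Pow)
  moreover have "partitions n = {M. set_mset M \<subseteq> {1..N} \<and> sum_mset M = n}"
    using assms part_le by (fastforce simp: partitions_def Suc_le_eq intro: gr0I)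
  ultimately show ?thesis by (simp add: overpartition_weight_def)
qed

lemma overpartition_weight_0: "overpartition_weight 0 n = (if n = 0 then 1 else 0)"
proof -
  have "{M. set_mset M \<subseteq> {1..0::nat} \<and> sum_mset M = n} = (if n = 0 then {{#}} else {})"
    by auto
  then show ?thesis by (simp add: overpartition_weight_def)
qed

text \<open>This is \<open>(1 - X^m) W m = (1 + X^m) W (m - 1)\<close> read off coefficientwise, for \<open>m = Suc N\<close>.
  Removing one copy of \<open>m\<close> from a partition that contains it leaves an arbitrary partition
  with parts at most \<open>m\<close>.  The weight is halved if that copy was the only one and unchanged
  otherwise, so partitions without \<open>m\<close> count once more on the right.\<close>

lemma overpartition_weight_Suc:
  "overpartition_weight (Suc N) n =
     overpartition_weight N n +
     (if n < Suc N then 0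
      else overpartition_weight N (n - Suc N) + overpartition_weight (Suc N) (n - Suc N))"
proof -
  let ?m = "Suc N"
  define B where "B N n = {M. set_mset M \<subseteq> {1..N} \<and> sum_mset M = (n::nat)}" for N n
  define C where "C n = {M \<in> B ?m n. ?m \<in># M}" for n
  define w where "w M = (2::nat) ^ card (set_mset M)" for M :: "nat multiset"
  have W: "overpartition_weight N n = sum w (B N n)" for N n
    by (simp add: overpartition_weight_def B_def w_def)
  have fin: "finite (B N n)" for N n
    unfolding B_def by (rule finite_bounded_partitions)
  have finC: "finite (C n)" for n using fin by (simp add: C_def)
  have "B ?m n = B N n \<union> C n" "B N n \<inter> C n = {}" for n
    by (auto simp: B_def C_def atLeastAtMostSuc_conv)
  then have split: "sum w (B ?m n) = sum w (B N n) + sum w (C n)" for n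
    by (simp add: sum.union_disjoint fin finC)
  show ?thesis
  proof (cases "n < ?m")
    case True
    have "C n = {}"
      using True by (auto simp: B_def C_def dest!: multi_member_split)
    then show ?thesis using True by (simp add: W split)
  next
    case False
    have "C n = add_mset ?m ` B ?m (n - ?m)"
    proof (intro equalityI subsetI)
      fix M assume M: "M \<in> C n"
      then obtain M' where "M = add_mset ?m M'"
        by (auto simp: C_def dest!: multi_member_split)
      then show "M \<in> add_mset ?m ` B ?m (n - ?m)" using M by (auto simp: B_def C_def)
    qed (use False in \<open>auto simp: B_def C_def\<close>)
    then have "sum w (C n) = (\<Sum>M\<in>B ?m (n - ?m). w (add_mset ?m M))"
      by (simp add: sum.reindex inj_on_def)
    also have "\<dots> = (\<Sum>M\<in>B N (n - ?m). w (add_mset ?m M)) + (\<Sum>M\<in>C (n - ?m). w (add_mset ?m M))"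
      unfolding \<open>\<And>n. B ?m n = B N n \<union> C n\<close>
      by (rule sum.union_disjoint) (use fin finC \<open>\<And>n. B N n \<inter> C n = {}\<close> in auto)
    also have "(\<Sum>M\<in>B N (n - ?m). w (add_mset ?m M)) = 2 * sum w (B N (n - ?m))"
      unfolding sum_distrib_left
    proof (rule sum.cong)
      fix M assume "M \<in> B N (n - ?m)"
      then have "?m \<notin># M" by (auto simp: B_def)
      then show "w (add_mset ?m M) = 2 * w M" by (simp add: w_def)
    qed simp
    also have "(\<Sum>M\<in>C (n - ?m). w (add_mset ?m M)) = sum w (C (n - ?m))"
      by (rule sum.cong) (auto simp: w_def C_def insert_absorb)
    finally show ?thesis using False by (simp add: W split)
  qed
qed

definition overpartition_product :: "nat \<Rightarrow> real fps" where
  "overpartition_product N = (\<Prod>k=1..N. (1 + fps_X ^ k) * inverse (1 - fps_X ^ k))"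

lemma fps_nth_overpartition_product:
  "overpartition_product N $ n = of_nat (overpartition_weight N n)"
proof -
  define W where "W N = (Abs_fps (\<lambda>n. of_nat (overpartition_weight N n)) :: real fps)" for N
  have step: "(1 - fps_X ^ Suc N) * W (Suc N) = (1 + fps_X ^ Suc N) * W N" for N
  proof (rule fps_ext)
    fix n
    show "((1 - fps_X ^ Suc N) * W (Suc N)) $ n = ((1 + fps_X ^ Suc N) * W N) $ n"
      using overpartition_weight_Suc[of N n]
      by (simp add: ring_distribs fps_X_power_mult_nth W_def del: power_Suc)
  qed
  have "W N = overpartition_product N" for N
  proof (induction N)
    case 0
    show ?case
      by (rule fps_ext) (simp add: W_def overpartition_product_def overpartition_weight_0)
  next
    case (Suc N)
    have "inverse (1 - fps_X ^ Suc N) * (1 - fps_X ^ Suc N) = (1 :: real fps)"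
      by (rule inverse_mult_eq_1) simp
    then have "W (Suc N) = inverse (1 - fps_X ^ Suc N) * ((1 - fps_X ^ Suc N) * W (Suc N))"
      by (simp add: mult.assoc[symmetric] del: power_Suc)
    also have "\<dots> = overpartition_product (Suc N)"
      unfolding step Suc.IH by (simp add: overpartition_product_def mult_ac del: power_Suc)
    finally show ?case .
  qed
  then show ?thesis by (metis W_def fps_nth_Abs_fps)
qed

section \<open>The generating function of the divisor sums\<close>

text \<open>The expansion of \<open>X^k / (1 - X^(2 k))\<close>, given by its coefficients so that they need not be
  extracted from a quotient.\<close>

definition odd_multiples :: "nat \<Rightarrow> real fps" where
  "odd_multiples k = Abs_fps (\<lambda>n. if k dvd n \<and> odd (n div k) then 1 else 0)"

lemma odd_multiples_mult:
  assumes "k > 0"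
  shows "(1 - fps_X ^ (2 * k)) * odd_multiples k = fps_X ^ k"
proof (rule fps_ext)
  fix n
  let ?P = "\<lambda>n. k dvd n \<and> odd (n div k)"
  have "?P n \<longleftrightarrow> ?P (n - 2 * k)" if "2 * k \<le> n"
  proof -
    define m where "m = n - 2 * k"
    then have m: "n = m + 2 * k" using that by simp
    have "(m + 2 * k) div k = 2 + m div k" by (rule div_mult_self1) (use assms in simp)
    moreover have "k dvd m + 2 * k \<longleftrightarrow> k dvd m" by (rule dvd_add_times_triv_right_iff)
    ultimately show ?thesis by (simp only: m add_diff_cancel_right' even_add even_numeral simp_thms)
  qed
  moreover have "?P n \<longleftrightarrow> n = k" if "n < 2 * k"
  proof
    assume "?P n"
    then have c: "n = k * (n div k)" "odd (n div k)" by simp_all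
    define c where "c = n div k"
    with c have c: "n = k * c" "odd c" by simp_all
    with that have "c < 2" by simp
    with c have "c = 1" by (auto simp: less_2_cases_iff)
    with c show "n = k" by simp
  qed (use assms in auto)
  ultimately show "((1 - fps_X ^ (2 * k)) * odd_multiples k) $ n = fps_X ^ k $ n"
    using assms by (cases "n < 2 * k") (simp_all add: left_diff_distrib fps_X_power_mult_nth odd_multiples_def)
qed

text \<open>In the coefficient of \<open>X^j\<close> the index \<open>k\<close> runs over the divisors of \<open>j\<close> with odd
  cofactor, and the sign is positive exactly for odd \<open>k\<close>.\<close>

definition sigma_oe_series :: "nat \<Rightarrow> real fps" where
  "sigma_oe_series N = (\<Sum>k=1..N. fps_const (- ((- 1) ^ k * of_nat k)) * odd_multiples k)"

lemma fps_nth_sigma_oe_series: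
  assumes "j \<le> N"
  shows "sigma_oe_series N $ j
           = real_of_int (sigma_oe j)"
proof (cases "j = 0")
  case True
  then show ?thesis by (simp add: sigma_oe_series_def fps_sum_nth odd_multiples_def sigma_oe_def)
next
  case False
  let ?D = "{d. d dvd j \<and> odd (j div d)}"
  have fin: "finite ?D" using False by simp
  have "sigma_oe_series N $ j
      = (\<Sum>k=1..N. if k \<in> ?D then - ((- 1) ^ k * real k) else 0)"
    by (auto simp: sigma_oe_series_def fps_sum_nth odd_multiples_def intro!: sum.cong)
  also have "\<dots> = (\<Sum>k\<in>{1..N} \<inter> ?D. - ((- 1) ^ k * real k))"
    by (rule sum.inter_restrict[symmetric]) simp
  also have "{1..N} \<inter> ?D = ?D"
    using assms False dvd_imp_le[of _ j] by (fastforce simp: Suc_le_eq intro: gr0I)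
  also have "(\<Sum>k\<in>?D. - ((- 1) ^ k * real k))
      = (\<Sum>k\<in>?D. (if odd k then real k else 0) - (if even k then real k else 0))"
    by (rule sum.cong) auto
  also have "\<dots> = (\<Sum>k\<in>{k \<in> ?D. odd k}. real k) - (\<Sum>k\<in>{k \<in> ?D. even k}. real k)"
    unfolding sum_subtractf sum.inter_filter[OF fin] ..
  also have "{k \<in> ?D. odd k} = {d. d dvd j \<and> odd d \<and> odd (j div d)}" by auto
  also have "{k \<in> ?D. even k} = {d. d dvd j \<and> even d \<and> odd (j div d)}" by auto
  finally show ?thesis using False by (simp add: sigma_oe_def)
qed

section \<open>Power series with nonnegative coefficients\<close>

definition nonneg_fps :: "real fps \<Rightarrow> bool" where
  "nonneg_fps f \<longleftrightarrow> (\<forall>n. f $ n \<ge> 0)"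

lemma nonneg_fps_mult: "nonneg_fps f \<Longrightarrow> nonneg_fps g \<Longrightarrow> nonneg_fps (f * g)"
  by (auto simp: nonneg_fps_def fps_mult_nth intro!: sum_nonneg)

lemma nonneg_fps_prod: "(\<And>x. x \<in> A \<Longrightarrow> nonneg_fps (f x)) \<Longrightarrow> nonneg_fps (prod f A)"
proof (induction A rule: infinite_finite_induct)
  case (insert x A)
  then show ?case by (simp add: nonneg_fps_mult)
qed (simp_all add: nonneg_fps_def)

lemma nonneg_fps_overpartition_factor:
  assumes "k > 0"
  shows "nonneg_fps ((1 + fps_X ^ k) * inverse (1 - fps_X ^ k))"
proof (rule nonneg_fps_mult)
  define g where "g = (Abs_fps (\<lambda>n. if k dvd n then 1 else 0) :: real fps)"
  have "g * (1 - fps_X ^ k) = 1"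
  proof (rule fps_ext)
    fix n
    have "k dvd n \<longleftrightarrow> n = 0" if "n < k" using that by (auto dest: dvd_imp_le)
    then show "(g * (1 - fps_X ^ k)) $ n = 1 $ n"
      using assms by (cases "n < k") (simp_all add: g_def right_diff_distrib fps_X_power_mult_right_nth dvd_minus_self)
  qed
  then have "inverse (1 - fps_X ^ k) = g"
    using assms by (intro fps_inverse_unique) (simp add: mult.commute)
  then show "nonneg_fps (inverse (1 - fps_X ^ k))"
    by (simp add: nonneg_fps_def g_def)
qed (simp add: nonneg_fps_def)

section \<open>The theta product\<close>

text \<open>The truncation of \<open>1 / P(-X)\<close>, with \<open>P\<close> the overpartition product.\<close>

definition theta_product :: "nat \<Rightarrow> real fps" where
  "theta_product N = (\<Prod>k=1..N. (1 - (- fps_X) ^ k) * inverse (1 + (- fps_X) ^ k))"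

text \<open>At \<open>q = - X\<close> the signs in the theta series disappear, because \<open>s\<close> and \<open>s^2\<close> have the same
  parity.\<close>

lemma fps_nth_theta_product:
  assumes "m \<le> N"
  shows "theta_product N $ m = (1 + 2 * (\<Sum>s=1..N. fps_X ^ (s\<^sup>2))) $ m"
proof -
  define A where "A k = (inverse (1 + (- fps_X) ^ k) :: real fps)" for k
  define u where "u s = 2 * (- 1) ^ s * (- fps_X) ^ (s * Suc N) * A s
      * (\<Prod>k\<in>{s<..N}. (1 - (- fps_X) ^ k) * A k)" for s
  have A: "A k * (1 + (- fps_X) ^ k) = 1" for k
    unfolding A_def by (rule inverse_mult_eq_1) (cases k, auto)
  have sq: "(- 1) ^ s * (- fps_X) ^ (s\<^sup>2) = (fps_X ^ (s\<^sup>2) :: real fps)" for s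
    by (cases "even s") (auto simp: power_minus_even power_minus_odd)
  have identity: "(\<Sum>s\<le>N. u s) = 1 + 2 * (\<Sum>s=1..N. fps_X ^ (s\<^sup>2))"
    using shanks_square_identity[of A "- fps_X" N, OF A] by (simp add: u_def sq)
  have "u 0 = (A 0 * (1 + (- fps_X) ^ 0)) * theta_product N"
    by (simp add: u_def theta_product_def A_def atLeastSucAtMost_greaterThanAtMost mult_ac)
  then have u0: "u 0 = theta_product N" by (simp only: A mult_1)
  have high: "u s $ m = 0" if "s \<noteq> 0" for s
  proof -
    have "m < s * Suc N" using assms that by (cases s) auto
    moreover have "u s = fps_X ^ (s * Suc N) * ((- 1) ^ (s * Suc N) * (2 * (- 1) ^ s * A s
        * (\<Prod>k\<in>{s<..N}. (1 - (- fps_X) ^ k) * A k)))"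
      unfolding u_def power_minus[of fps_X] by (simp only: mult_ac)
    ultimately show ?thesis by (simp only: fps_X_power_mult_nth if_True)
  qed
  have "(\<Sum>s\<le>N. u s) $ m = (\<Sum>s\<le>N. if s = 0 then u s $ m else 0)"
    unfolding fps_sum_nth by (rule sum.cong) (use high in auto)
  also have "\<dots> = theta_product N $ m" by (simp add: u0)
  finally show ?thesis using identity by simp
qed

text \<open>With \<open>y = (- X)^k\<close> one has \<open>X y' = k y\<close>, so the factor \<open>(1 - y) / (1 + y)\<close> contributes
  \<open>- k y / (1 - y) - k y / (1 + y) = - 2 k y / (1 - y^2)\<close> to the logarithmic derivative, and
  \<open>y / (1 - y^2) = (-1)^k X^k / (1 - X^(2 k))\<close>.\<close>

lemma theta_product_log_deriv:
  "fps_X * fps_deriv (theta_product N) =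
     2 * theta_product N * sigma_oe_series N"
proof (induction N)
  case 0
  show ?case by (simp add: theta_product_def sigma_oe_series_def)
next
  case (Suc N)
  let ?m = "Suc N"
  let ?c = "fps_const (- ((- 1) ^ ?m * of_nat ?m)) :: real fps"
  define y where "y = ((- fps_X) ^ ?m :: real fps)"
  define i where "i = inverse (1 + y)"
  define E where "E = odd_multiples ?m"
  have i: "i * (1 + y) = 1"
    unfolding i_def y_def by (rule inverse_mult_eq_1) simp
  have c: "?c = - ((- 1) ^ ?m * of_nat ?m)"
    by (cases "even N")
       (simp_all add: fps_of_nat fps_const_neg[symmetric] del: fps_const_neg of_nat_Suc)
  have dy: "fps_X * fps_deriv y = of_nat ?m * y"
    unfolding y_def fps_deriv_power by (simp add: fps_of_nat mult_ac del: of_nat_Suc)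
  have e: "(- 1) ^ ?m * (- 1) ^ ?m = (1 :: real fps)"
    by (simp only: power_mult_distrib[symmetric] minus_mult_minus mult_1 power_one)
  have y: "y = (- 1) ^ ?m * fps_X ^ ?m"
    unfolding y_def by (rule power_minus)
  have "y * y = fps_X ^ (2 * ?m)"
    unfolding y_def by (simp only: power_mult_distrib[symmetric] minus_mult_minus power_mult power2_eq_square)
  moreover have "fps_X ^ ?m = (- 1) ^ ?m * y"
    unfolding y by (simp only: mult.assoc[symmetric] e mult_1)
  ultimately have yE: "(1 - y * y) * E = (- 1) ^ ?m * y"
    using odd_multiples_mult[of ?m] by (simp add: E_def del: power_Suc)
  have di: "fps_deriv i = - fps_deriv y * i * i"
    unfolding i_def by (subst fps_inverse_deriv) (simp_all add: y_def power2_eq_square)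
  have T: "theta_product ?m = theta_product N * ((1 - y) * i)"
    by (simp add: theta_product_def y_def i_def del: power_Suc)
  have factor: "fps_X * fps_deriv ((1 - y) * i) = 2 * ((1 - y) * i) * (?c * E)"
  proof -
    have "fps_X * fps_deriv ((1 - y) * i) = - (fps_X * fps_deriv y) * i * (1 + (1 - y) * i)"
      by (simp add: di algebra_simps)
    also have "\<dots> = - of_nat ?m * y * i * (1 + (1 - y) * i)"
      by (simp only: dy mult_minus_left)
    also have "1 + (1 - y) * i = 2 * i"
      using i by (simp add: algebra_simps)
    also have "- of_nat ?m * y * i * (2 * i)
        = - 2 * of_nat ?m * i * (- 1) ^ ?m * (i * ((- 1) ^ ?m * y))"
      using e by (simp add: mult_ac del: power_Suc)
    also have "i * ((- 1) ^ ?m * y) = (i * (1 + y)) * ((1 - y) * E)"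
      unfolding yE[symmetric] by (simp add: algebra_simps)
    also have "- 2 * of_nat ?m * i * (- 1) ^ ?m * ((i * (1 + y)) * ((1 - y) * E))
        = 2 * ((1 - y) * i) * (- ((- 1) ^ ?m * of_nat ?m) * E)"
      unfolding i by (simp only: mult_ac mult_minus_left mult_minus_right mult_1)
    finally show ?thesis by (simp only: c)
  qed
  have "fps_X * fps_deriv (theta_product ?m)
      = fps_X * fps_deriv (theta_product N) * ((1 - y) * i)
        + theta_product N * (fps_X * fps_deriv ((1 - y) * i))"
    unfolding T fps_deriv_mult by (simp only: distrib_left mult_ac add_ac)
  also have "\<dots> = 2 * theta_product ?m
      * (sigma_oe_series N + ?c * E)"
    unfolding factor Suc.IH T by (simp only: distrib_left mult_ac)
  finally show ?case by (simp add: E_def sigma_oe_series_def del: power_Suc)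
qed

text \<open>The quotient \<open>F\<close> is the truncation of \<open>P(X) P(-X)\<close>: its factors for odd \<open>k\<close> are \<open>1\<close>, and for
  even \<open>k\<close> they are squares of series with nonnegative coefficients.\<close>

lemma overpartition_product_eq_nonneg_mult_theta_product:
  obtains F where "nonneg_fps F" "overpartition_product N = F * theta_product N"
proof
  let ?p = "\<lambda>k. (1 + fps_X ^ k) * inverse (1 - fps_X ^ k) :: real fps"
  let ?f = "\<lambda>k. if even k then ?p k * ?p k else 1"
  show "nonneg_fps (prod ?f {1..N})"
  proof (rule nonneg_fps_prod)
    fix k assume "k \<in> {1..N}"
    then have "nonneg_fps (?p k)" by (intro nonneg_fps_overpartition_factor) simp
    then show "nonneg_fps (?f k)" by (simp add: nonneg_fps_mult) (simp add: nonneg_fps_def)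
  qed
  show "overpartition_product N = prod ?f {1..N} * theta_product N"
    unfolding overpartition_product_def theta_product_def prod.distrib[symmetric]
  proof (rule prod.cong)
    fix k assume "k \<in> {1..N}"
    then have k: "k > 0" by simp
    have "inverse (1 - fps_X ^ k) * (1 - fps_X ^ k) = (1 :: real fps)"
         "inverse (1 + fps_X ^ k) * (1 + fps_X ^ k) = (1 :: real fps)"
      using k by (auto intro: inverse_mult_eq_1)
    moreover have "?p k * ?p k * ((1 - fps_X ^ k) * inverse (1 + fps_X ^ k))
        = ?p k * ((inverse (1 - fps_X ^ k) * (1 - fps_X ^ k)) * (inverse (1 + fps_X ^ k) * (1 + fps_X ^ k)))"
      by (simp only: mult_ac)
    ultimately show "?p k = ?f k * ((1 - (- fps_X) ^ k) * inverse (1 + (- fps_X) ^ k))"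
      by (cases "even k") simp_all
  qed simp
qed

section \<open>Nonnegativity of the convolution\<close>

theorem corollary5:
  fixes n :: nat
  assumes "n \<ge> 1"
  shows "(\<Sum>k=0..n. int (overpartition_count k) * sigma_oe (n - k)) \<ge> 0"
proof -
  define P where "P = overpartition_product n"
  define R where "R = theta_product n"
  define S where "S = sigma_oe_series n"
  obtain F where F: "nonneg_fps F" "P = F * R"
    unfolding P_def R_def by (rule overpartition_product_eq_nonneg_mult_theta_product)
  have "2 * (P * S) = F * (fps_X * fps_deriv R)"
    using theta_product_log_deriv[of n] by (simp add: F R_def S_def algebra_simps)
  moreover have "(fps_X * fps_deriv R) $ k \<ge> 0" if "k \<le> n" for k
  proof -
    have "R $ k \<ge> 0"
      unfolding R_def fps_nth_theta_product[OF that]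
      by (auto simp: fps_sum_nth numeral_fps_const intro!: sum_nonneg add_nonneg_nonneg)
    then show ?thesis by (cases k) auto
  qed
  then have "(F * (fps_X * fps_deriv R)) $ n \<ge> 0"
    using F(1) unfolding fps_mult_nth[of F] nonneg_fps_def
    by (intro sum_nonneg mult_nonneg_nonneg) (blast, simp only: diff_le_self)
  ultimately have "(2 * (P * S)) $ n \<ge> 0" by simp
  then have "(P * S) $ n \<ge> 0" by (simp add: numeral_fps_const)
  also have "(P * S) $ n = (\<Sum>k=0..n. real (overpartition_count k) * real_of_int (sigma_oe (n - k)))"
    unfolding fps_mult_nth
  proof (rule sum.cong)
    fix k assume "k \<in> {0..n}"
    then have "P $ k = real (overpartition_count k)" "S $ (n - k) = real_of_int (sigma_oe (n - k))"
      unfolding P_def S_def fps_nth_overpartition_product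
      by (simp add: overpartition_count_eq_weight[of k n], intro fps_nth_sigma_oe_series) simp
    then show "P $ k * S $ (n - k) = real (overpartition_count k) * real_of_int (sigma_oe (n - k))"
      by simp
  qed simp
  also have "\<dots> = real_of_int (\<Sum>k=0..n. int (overpartition_count k) * sigma_oe (n - k))"
    by simp
  finally show ?thesis by (simp only: of_int_0_le_iff)
qed

end
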